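(* Let $\mathcal{C}$ be a category with an involution $*$ such that every morphism of $\mathcal{C}$ has a Moore-Penrose generalized inverse with respect to $*$. Then $\mathcal{C}$ is exact if and only if $\mathcal{C}$ (with the involution $*$) is a Baer*-category in which every projection is closed and every projection $i$ can be written as a composition $i = pq$ where $p$ is a monomorphism and $q$ is an epimorphism.
   Context: Composition convention: $fg$ means first $g$, then $f$. An involution $*$ of a category is a contravariant endofunctor $f \mapsto f^*$ that is the identity on objects and satisfies $(f^* )^* = f$. In a category with involution $*$, a Moore-Penrose generalized inverse of a morphism $f: A \to B$ is a morphism $g: B \to A$ with $fgf = f$, $gfg = g$, $(fg)^* = fg$ and $(gf)^* = gf$; it is unique if it exists. A projection is an endomorphism $i$ with $i^2 = i$ and $i^* = i$. A Baer*-category is a category $\mathcal{B}$ with zero object and with an involution $*$ such that for each morphism $f: A \to B$ there exists a (unique) projection $f': A \to A$ with $\{g \in \mathcal{B} \mid fg = 0\} = f'\mathcal{B}$, where $g$ ranges over the morphisms of $\mathcal{B}$ with codomain $A$ and $f'\mathcal{B}$ is the set of all composites $f'h$ with $h$ a morphism of $\mathcal{B}$ with codomain $A$. A projection $i$ of a Baer*-category is closed if $(i')' = i$. An exact category is a category with zero object that has kernels and cokernels, is normal (every monomorphism is the kernel of some morphism) and conormal (every epimorphism is the cokernel of some morphism), and in which every morphism $f$ can be written as a composition $f = pq$ with $p$ a monomorphism and $q$ an epimorphism (no additive structure is assumed). *)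

theory Defs
  imports Main
begin

text \<open>Composition is written \<open>f \<odot> g\<close> for ``first \<open>g\<close>, then \<open>f\<close>''. It is a total function on the type of
  arrows, meaningful only when \<open>Dom f = Cod g\<close>; every definition below guards it accordingly.\<close>

record ('o, 'a) cat_struct =
  Obj :: "'o set"
  Arr :: "'a set"
  Dom :: "'a \<Rightarrow> 'o"
  Cod :: "'a \<Rightarrow> 'o"
  Ident :: "'o \<Rightarrow> 'a"
  Comp :: "'a \<Rightarrow> 'a \<Rightarrow> 'a"  (infixl "\<odot>\<index>" 70)

definition hom :: "('o, 'a, 'r) cat_struct_scheme \<Rightarrow> 'o \<Rightarrow> 'o \<Rightarrow> 'a set" where
  "hom C A B = {f \<in> Arr C. Dom C f = A \<and> Cod C f = B}"

locale category =
  fixes C :: "('o, 'a, 'r) cat_struct_scheme" (structure)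
  assumes Dom_in_Obj: "f \<in> Arr C \<Longrightarrow> Dom C f \<in> Obj C"
    and Cod_in_Obj: "f \<in> Arr C \<Longrightarrow> Cod C f \<in> Obj C"
    and Ident_in_hom: "A \<in> Obj C \<Longrightarrow> Ident C A \<in> hom C A A"
    and Comp_in_hom: "f \<in> hom C B D \<Longrightarrow> g \<in> hom C A B \<Longrightarrow> f \<odot> g \<in> hom C A D"
    and Comp_Ident: "f \<in> hom C A B \<Longrightarrow> f \<odot> Ident C A = f"
    and Ident_Comp: "f \<in> hom C A B \<Longrightarrow> Ident C B \<odot> f = f"
    and Comp_assoc: "f \<in> hom C D E \<Longrightarrow> g \<in> hom C B D \<Longrightarrow> h \<in> hom C A B \<Longrightarrow>
      (f \<odot> g) \<odot> h = f \<odot> (g \<odot> h)"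

locale involution_category = category C
  for C :: "('o, 'a, 'r) cat_struct_scheme" (structure) +
  fixes star :: "'a \<Rightarrow> 'a"
  assumes star_in_hom: "f \<in> hom C A B \<Longrightarrow> star f \<in> hom C B A"
    and star_Ident: "A \<in> Obj C \<Longrightarrow> star (Ident C A) = Ident C A"
    and star_Comp: "f \<in> hom C B D \<Longrightarrow> g \<in> hom C A B \<Longrightarrow> star (f \<odot> g) = star g \<odot> star f"
    and star_star: "f \<in> Arr C \<Longrightarrow> star (star f) = f"

definition monic :: "('o, 'a, 'r) cat_struct_scheme \<Rightarrow> 'a \<Rightarrow> bool" where
  "monic C f \<longleftrightarrow> f \<in> Arr C \<and>
    (\<forall>X. \<forall>g \<in> hom C X (Dom C f). \<forall>h \<in> hom C X (Dom C f). f \<odot>\<^bsub>C\<^esub> g = f \<odot>\<^bsub>C\<^esub> h \<longrightarrow> g = h)"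

definition epic :: "('o, 'a, 'r) cat_struct_scheme \<Rightarrow> 'a \<Rightarrow> bool" where
  "epic C f \<longleftrightarrow> f \<in> Arr C \<and>
    (\<forall>X. \<forall>g \<in> hom C (Cod C f) X. \<forall>h \<in> hom C (Cod C f) X. g \<odot>\<^bsub>C\<^esub> f = h \<odot>\<^bsub>C\<^esub> f \<longrightarrow> g = h)"

definition mono_epi_factorizable :: "('o, 'a, 'r) cat_struct_scheme \<Rightarrow> 'a \<Rightarrow> bool" where
  "mono_epi_factorizable C f \<longleftrightarrow>
    (\<exists>p q. monic C p \<and> epic C q \<and> Dom C p = Cod C q \<and> f = p \<odot>\<^bsub>C\<^esub> q)"

definition zero_object :: "('o, 'a, 'r) cat_struct_scheme \<Rightarrow> 'o \<Rightarrow> bool" where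
  "zero_object C Z \<longleftrightarrow> Z \<in> Obj C \<and>
    (\<forall>A \<in> Obj C. (\<exists>!f. f \<in> hom C Z A) \<and> (\<exists>!f. f \<in> hom C A Z))"

definition zero_arrow :: "('o, 'a, 'r) cat_struct_scheme \<Rightarrow> 'a \<Rightarrow> bool" where
  "zero_arrow C f \<longleftrightarrow> f \<in> Arr C \<and>
    (\<exists>Z. zero_object C Z \<and> (\<exists>g \<in> hom C (Dom C f) Z. \<exists>h \<in> hom C Z (Cod C f). f = h \<odot>\<^bsub>C\<^esub> g))"

definition is_kernel :: "('o, 'a, 'r) cat_struct_scheme \<Rightarrow> 'a \<Rightarrow> 'a \<Rightarrow> bool" where
  "is_kernel C f k \<longleftrightarrow> f \<in> Arr C \<and> k \<in> Arr C \<and> Cod C k = Dom C f \<and> zero_arrow C (f \<odot>\<^bsub>C\<^esub> k) \<and>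
    (\<forall>X. \<forall>g \<in> hom C X (Dom C f). zero_arrow C (f \<odot>\<^bsub>C\<^esub> g) \<longrightarrow>
      (\<exists>!h. h \<in> hom C X (Dom C k) \<and> k \<odot>\<^bsub>C\<^esub> h = g))"

definition is_cokernel :: "('o, 'a, 'r) cat_struct_scheme \<Rightarrow> 'a \<Rightarrow> 'a \<Rightarrow> bool" where
  "is_cokernel C f c \<longleftrightarrow> f \<in> Arr C \<and> c \<in> Arr C \<and> Dom C c = Cod C f \<and> zero_arrow C (c \<odot>\<^bsub>C\<^esub> f) \<and>
    (\<forall>X. \<forall>g \<in> hom C (Cod C f) X. zero_arrow C (g \<odot>\<^bsub>C\<^esub> f) \<longrightarrow>
      (\<exists>!h. h \<in> hom C (Cod C c) X \<and> h \<odot>\<^bsub>C\<^esub> c = g))"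

text \<open>No additive structure is assumed.\<close>

definition exact_category :: "('o, 'a, 'r) cat_struct_scheme \<Rightarrow> bool" where
  "exact_category C \<longleftrightarrow> category C \<and>
    (\<exists>Z. zero_object C Z) \<and>
    (\<forall>f \<in> Arr C. \<exists>k. is_kernel C f k) \<and>
    (\<forall>f \<in> Arr C. \<exists>c. is_cokernel C f c) \<and>
    (\<forall>m. monic C m \<longrightarrow> (\<exists>f. is_kernel C f m)) \<and>
    (\<forall>e. epic C e \<longrightarrow> (\<exists>f. is_cokernel C f e)) \<and>
    (\<forall>f \<in> Arr C. mono_epi_factorizable C f)"

definition moore_penrose_inverse ::
    "('o, 'a, 'r) cat_struct_scheme \<Rightarrow> ('a \<Rightarrow> 'a) \<Rightarrow> 'a \<Rightarrow> 'a \<Rightarrow> bool" where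
  "moore_penrose_inverse C star f g \<longleftrightarrow> f \<in> Arr C \<and> g \<in> hom C (Cod C f) (Dom C f) \<and>
    f \<odot>\<^bsub>C\<^esub> g \<odot>\<^bsub>C\<^esub> f = f \<and> g \<odot>\<^bsub>C\<^esub> f \<odot>\<^bsub>C\<^esub> g = g \<and>
    star (f \<odot>\<^bsub>C\<^esub> g) = f \<odot>\<^bsub>C\<^esub> g \<and> star (g \<odot>\<^bsub>C\<^esub> f) = g \<odot>\<^bsub>C\<^esub> f"

definition projection :: "('o, 'a, 'r) cat_struct_scheme \<Rightarrow> ('a \<Rightarrow> 'a) \<Rightarrow> 'a \<Rightarrow> bool" where
  "projection C star i \<longleftrightarrow> i \<in> Arr C \<and> Dom C i = Cod C i \<and> i \<odot>\<^bsub>C\<^esub> i = i \<and> star i = i"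

text \<open>\<open>is_ann_projection C star f e\<close> says that \<open>e\<close> is a projection \<open>f'\<close> generating the right
  annihilator of \<open>f\<close>.\<close>

definition is_ann_projection ::
    "('o, 'a, 'r) cat_struct_scheme \<Rightarrow> ('a \<Rightarrow> 'a) \<Rightarrow> 'a \<Rightarrow> 'a \<Rightarrow> bool" where
  "is_ann_projection C star f e \<longleftrightarrow> projection C star e \<and> Dom C e = Dom C f \<and>
    {g \<in> Arr C. Cod C g = Dom C f \<and> zero_arrow C (f \<odot>\<^bsub>C\<^esub> g)} =
    {e \<odot>\<^bsub>C\<^esub> h |h. h \<in> Arr C \<and> Cod C h = Dom C f}"

text \<open>The arrow \<open>f'\<close>; meaningful in a Baer*-category.\<close>

definition ann_projection ::
    "('o, 'a, 'r) cat_struct_scheme \<Rightarrow> ('a \<Rightarrow> 'a) \<Rightarrow> 'a \<Rightarrow> 'a" where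
  "ann_projection C star f = (THE e. is_ann_projection C star f e)"

definition baer_star_category ::
    "('o, 'a, 'r) cat_struct_scheme \<Rightarrow> ('a \<Rightarrow> 'a) \<Rightarrow> bool" where
  "baer_star_category C star \<longleftrightarrow> involution_category C star \<and> (\<exists>Z. zero_object C Z) \<and>
    (\<forall>f \<in> Arr C. \<exists>!e. is_ann_projection C star f e)"

definition closed_projection ::
    "('o, 'a, 'r) cat_struct_scheme \<Rightarrow> ('a \<Rightarrow> 'a) \<Rightarrow> 'a \<Rightarrow> bool" where
  "closed_projection C star i \<longleftrightarrow> projection C star i \<and>
    ann_projection C star (ann_projection C star i) = i"

end

theory Submission
  imports Defs
begin

text \<open>
  The bridge between the two sides is the correspondence between subobjects and projections.  If
  \<open>m\<close> is a monomorphism with Moore-Penrose inverse \<open>n\<close>, then \<open>m \<odot> n\<close> is a projection, and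
  \<open>m \<odot> n \<odot> m = m\<close> shows that it has the same image as \<open>m\<close>.  Conversely, in a
  factorization \<open>i = p \<odot> q\<close> of a projection into a monomorphism and an epimorphism, idempotence of
  \<open>i\<close> forces \<open>q \<odot> p = 1\<close> (\<open>idempotent_factorization_split\<close>), so \<open>p\<close> is a subobject with the same
  image as \<open>i\<close>.

  Under this correspondence the kernel of \<open>f\<close> becomes the projection generating the right
  annihilator of \<open>f\<close>, so a category with kernels is a Baer*-category
  (\<open>kernel_imp_ann_projection\<close>), and in a Baer*-category whose projections factor all kernels exist
  (\<open>ann_projection_imp_kernel\<close>).  Likewise, normality becomes closedness of projections: if \<open>p\<close> is
  a kernel of some arrow, the involution shows that it is also a kernel of \<open>i'\<close>, whence \<open>i'' = i\<close>
  (\<open>kernel_imp_double_annihilator\<close>); and if \<open>i = m \<odot> n\<close> satisfies \<open>i'' = i\<close>, then \<open>m\<close> is a kernel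
  of \<open>i'\<close> (\<open>double_annihilator_imp_kernel\<close>).

  A factorization of an arbitrary \<open>f\<close> comes from one of the projection \<open>f \<odot> n\<close> onto its range,
  where \<open>n\<close> is its Moore-Penrose inverse (\<open>factorizable_range_imp_factorizable\<close>).  All
  statements about cokernels and epimorphisms follow from those about kernels and monomorphisms
  because the involution is a duality of the category with itself.
\<close>

section \<open>Zero arrows\<close>

context category
begin

lemma comp_arr [simp]:
  assumes "f \<in> Arr C" "g \<in> Arr C" "Dom C f = Cod C g"
  shows "f \<odot> g \<in> Arr C" "Dom C (f \<odot> g) = Dom C g" "Cod C (f \<odot> g) = Cod C f"
  using Comp_in_hom[of f "Dom C f" "Cod C f" g "Dom C g"] assms by (auto simp: hom_def)

lemma comp_assoc_arr:
  assumes "f \<in> Arr C" "g \<in> Arr C" "h \<in> Arr C" "Dom C f = Cod C g" "Dom C g = Cod C h"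
  shows "f \<odot> g \<odot> h = f \<odot> (g \<odot> h)"
  using Comp_assoc[of f "Dom C f" "Cod C f" g "Dom C g" h "Dom C h"] assms by (auto simp: hom_def)

lemma ident_arr [simp]:
  assumes "A \<in> Obj C"
  shows "Ident C A \<in> Arr C" "Dom C (Ident C A) = A" "Cod C (Ident C A) = A"
  using Ident_in_hom[OF assms] by (auto simp: hom_def)

lemma comp_ident_arr [simp]: "f \<in> Arr C \<Longrightarrow> Dom C f = A \<Longrightarrow> f \<odot> Ident C A = f"
  and ident_comp_arr [simp]: "f \<in> Arr C \<Longrightarrow> Cod C f = A \<Longrightarrow> Ident C A \<odot> f = f"
  using Comp_Ident Ident_Comp by (auto simp: hom_def)

lemma monicD:
  assumes "monic C f" "f \<odot> g = f \<odot> h" "g \<in> Arr C" "h \<in> Arr C"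
    and "Cod C g = Dom C f" "Cod C h = Dom C f" "Dom C g = Dom C h"
  shows "g = h"
  using assms by (auto simp: monic_def hom_def)

lemma epicD:
  assumes "epic C f" "g \<odot> f = h \<odot> f" "g \<in> Arr C" "h \<in> Arr C"
    and "Dom C g = Cod C f" "Dom C h = Cod C f" "Cod C g = Cod C h"
  shows "g = h"
  using assms by (auto simp: epic_def hom_def)

lemma zero_object_from: "zero_object C Z \<Longrightarrow> A \<in> Obj C \<Longrightarrow> \<exists>f. f \<in> hom C Z A"
  and zero_object_to: "zero_object C Z \<Longrightarrow> A \<in> Obj C \<Longrightarrow> \<exists>f. f \<in> hom C A Z"
  unfolding zero_object_def by blast+

lemma zero_object_from_unique:
  assumes "zero_object C Z" "f \<in> hom C Z A" "g \<in> hom C Z A"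
  shows "f = g"
proof -
  have "A \<in> Obj C" using assms(2) Cod_in_Obj by (auto simp: hom_def)
  then have "\<exists>!f. f \<in> hom C Z A" using assms(1) by (simp add: zero_object_def)
  then show ?thesis using assms(2,3) by blast
qed

lemma zero_object_to_unique:
  assumes "zero_object C Z" "f \<in> hom C A Z" "g \<in> hom C A Z"
  shows "f = g"
proof -
  have "A \<in> Obj C" using assms(2) Dom_in_Obj by (auto simp: hom_def)
  then have "\<exists>!f. f \<in> hom C A Z" using assms(1) by (simp add: zero_object_def)
  then show ?thesis using assms(2,3) by blast
qed

lemma zero_arrowI:
  assumes "zero_object C Z" "k \<in> hom C A Z" "h \<in> hom C Z B"
  shows "zero_arrow C (h \<odot> k)"
proof -
  have "h \<odot> k \<in> hom C A B" using assms by (intro Comp_in_hom)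
  then have "h \<odot> k \<in> Arr C" "Dom C (h \<odot> k) = A" "Cod C (h \<odot> k) = B" by (auto simp: hom_def)
  then show ?thesis using assms unfolding zero_arrow_def by blast
qed

lemma zero_arrowE:
  assumes "zero_arrow C f"
  obtains Z k h where "zero_object C Z" "k \<in> hom C (Dom C f) Z" "h \<in> hom C Z (Cod C f)" "f = h \<odot> k"
  using assms unfolding zero_arrow_def by blast

lemma zero_arrow_comp_right:
  assumes "zero_arrow C f" "g \<in> Arr C" "Dom C f = Cod C g"
  shows "zero_arrow C (f \<odot> g)"
proof -
  obtain Z k h where Z: "zero_object C Z" and k: "k \<in> hom C (Dom C f) Z"
    and h: "h \<in> hom C Z (Cod C f)" and f: "f = h \<odot> k"
    using assms(1) by (rule zero_arrowE)
  have g: "g \<in> hom C (Dom C g) (Dom C f)" using assms by (simp add: hom_def)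
  have "f \<odot> g = h \<odot> (k \<odot> g)" by (subst f) (rule Comp_assoc[OF h k g])
  then show ?thesis using zero_arrowI[OF Z Comp_in_hom[OF k g] h] by simp
qed

lemma zero_arrow_comp_left:
  assumes "zero_arrow C f" "g \<in> Arr C" "Dom C g = Cod C f"
  shows "zero_arrow C (g \<odot> f)"
proof -
  obtain Z k h where Z: "zero_object C Z" and k: "k \<in> hom C (Dom C f) Z"
    and h: "h \<in> hom C Z (Cod C f)" and f: "f = h \<odot> k"
    using assms(1) by (rule zero_arrowE)
  have g: "g \<in> hom C (Cod C f) (Cod C g)" using assms by (simp add: hom_def)
  have "g \<odot> f = g \<odot> h \<odot> k" by (subst f) (rule Comp_assoc[OF g h k, symmetric])
  then show ?thesis using zero_arrowI[OF Z k Comp_in_hom[OF g h]] by simp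
qed

text \<open>The two arrows may factor through different zero objects \<open>Z\<close> and \<open>Z'\<close>; the comparison
  arrow \<open>Z \<rightarrow> Z'\<close> identifies both factorizations.\<close>

lemma zero_arrow_unique:
  assumes "zero_arrow C f" "zero_arrow C g" "Dom C f = Dom C g" "Cod C f = Cod C g"
  shows "f = g"
proof -
  obtain Z k h where f: "zero_object C Z" "k \<in> hom C (Dom C f) Z" "h \<in> hom C Z (Cod C f)" "f = h \<odot> k"
    using assms(1) by (rule zero_arrowE)
  obtain Z' k' h' where g: "zero_object C Z'" "k' \<in> hom C (Dom C f) Z'"
    "h' \<in> hom C Z' (Cod C f)" "g = h' \<odot> k'"
    using zero_arrowE[OF assms(2)] unfolding assms(3,4) .
  have "Z' \<in> Obj C" using g(1) by (simp add: zero_object_def)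
  then obtain u where u: "u \<in> hom C Z Z'"
    using zero_object_from[OF f(1)] by blast
  have "h' \<odot> u = h"
    by (rule zero_object_from_unique[OF f(1) Comp_in_hom[OF g(3) u] f(3)])
  moreover have "u \<odot> k = k'"
    by (rule zero_object_to_unique[OF g(1) Comp_in_hom[OF u f(2)] g(2)])
  ultimately show ?thesis
    using f(4) g(4) Comp_assoc[OF g(3) u f(2)] by simp
qed

lemma zero_arrow_exists:
  assumes "zero_object C Z" "A \<in> Obj C" "B \<in> Obj C"
  shows "\<exists>z \<in> hom C A B. zero_arrow C z"
proof -
  obtain k h where "k \<in> hom C A Z" "h \<in> hom C Z B"
    using zero_object_to[OF assms(1,2)] zero_object_from[OF assms(1,3)] by blast
  moreover from this have "h \<odot> k \<in> hom C A B" by (rule Comp_in_hom[rotated])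
  ultimately show ?thesis
    using zero_arrowI[OF assms(1)] by blast
qed

lemma zero_arrow_cancel_epic:
  assumes "zero_arrow C (f \<odot> q)" "epic C q" "f \<in> Arr C" "Dom C f = Cod C q"
  shows "zero_arrow C f"
proof -
  have q: "q \<in> Arr C" using assms(2) by (simp add: epic_def)
  obtain Z where "zero_object C Z" using assms(1) by (rule zero_arrowE)
  then obtain z where z: "z \<in> hom C (Dom C f) (Cod C f)" "zero_arrow C z"
    using zero_arrow_exists assms(3) Dom_in_Obj Cod_in_Obj by blast
  have "zero_arrow C (z \<odot> q)"
    using z assms(4) q by (intro zero_arrow_comp_right) (auto simp: hom_def)
  then have "z \<odot> q = f \<odot> q"
    by (rule zero_arrow_unique[OF _ assms(1)]) (use assms q z in \<open>auto simp: hom_def\<close>)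
  then have "z = f"
    using epicD[OF assms(2)] assms z by (auto simp: hom_def)
  with z show ?thesis by simp
qed

lemma kernel_monic:
  assumes "is_kernel C f k"
  shows "monic C k"
  unfolding monic_def
proof (intro conjI allI ballI impI)
  show "k \<in> Arr C" using assms by (simp add: is_kernel_def)
  fix X g h
  assume gh: "g \<in> hom C X (Dom C k)" "h \<in> hom C X (Dom C k)" and eq: "k \<odot> g = k \<odot> h"
  have k: "f \<in> Arr C" "k \<in> Arr C" "Cod C k = Dom C f" "zero_arrow C (f \<odot> k)"
    using assms by (auto simp: is_kernel_def)
  have "k \<odot> g \<in> hom C X (Dom C f)" using gh k by (auto simp: hom_def)
  moreover have "zero_arrow C (f \<odot> (k \<odot> g))"
    using zero_arrow_comp_right[OF k(4), of g] gh k by (auto simp: hom_def comp_assoc_arr)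
  ultimately have "\<exists>!l. l \<in> hom C X (Dom C k) \<and> k \<odot> l = k \<odot> g"
    using assms unfolding is_kernel_def by blast
  then show "g = h" using gh eq by metis
qed

lemma kernel_factor:
  assumes "is_kernel C f k" "g \<in> Arr C" "Cod C g = Dom C f" "zero_arrow C (f \<odot> g)"
  obtains h where "h \<in> Arr C" "Cod C h = Dom C k" "g = k \<odot> h"
proof -
  have "g \<in> hom C (Dom C g) (Dom C f)" using assms by (simp add: hom_def)
  then obtain h where "h \<in> hom C (Dom C g) (Dom C k)" "k \<odot> h = g"
    using assms unfolding is_kernel_def by blast
  then show ?thesis using that by (auto simp: hom_def)
qed

lemma monic_imp_is_kernel:
  assumes "monic C k" "f \<in> Arr C" "Cod C k = Dom C f" "zero_arrow C (f \<odot> k)"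
    and factor: "\<And>g. g \<in> Arr C \<Longrightarrow> Cod C g = Dom C f \<Longrightarrow> zero_arrow C (f \<odot> g) \<Longrightarrow>
      \<exists>h \<in> hom C (Dom C g) (Dom C k). k \<odot> h = g"
  shows "is_kernel C f k"
  unfolding is_kernel_def
proof (intro conjI allI ballI impI)
  show "k \<in> Arr C" using assms(1) by (simp add: monic_def)
  fix X g
  assume "g \<in> hom C X (Dom C f)" "zero_arrow C (f \<odot> g)"
  then obtain h where h: "h \<in> hom C X (Dom C k)" "k \<odot> h = g"
    using factor[of g] by (auto simp: hom_def)
  moreover have "l = h" if "l \<in> hom C X (Dom C k)" "k \<odot> l = g" for l
    using assms(1) h that unfolding monic_def by blast
  ultimately show "\<exists>!h. h \<in> hom C X (Dom C k) \<and> k \<odot> h = g" by blast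
qed (use assms in auto)

text \<open>Cancelling \<open>p\<close> on the left and \<open>q\<close> on the right in \<open>p \<odot> q \<odot> p \<odot> q = p \<odot> q\<close>: an idempotent
  that factors is split.\<close>

lemma idempotent_factorization_split:
  assumes "monic C p" "epic C q" "Dom C p = Cod C q" "Cod C p = Dom C q"
    and "p \<odot> q \<odot> (p \<odot> q) = p \<odot> q"
  shows "q \<odot> p = Ident C (Dom C p)"
proof -
  have pq: "p \<in> Arr C" "q \<in> Arr C" using assms by (auto simp: monic_def epic_def)
  then have ob: "Dom C p \<in> Obj C" by (simp add: Dom_in_Obj)
  have "p \<odot> (q \<odot> p \<odot> q) = p \<odot> q"
    using assms pq by (simp add: comp_assoc_arr)
  then have "q \<odot> p \<odot> q = q"
    by (rule monicD[OF assms(1)]) (use assms pq in auto)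
  then have "q \<odot> p \<odot> q = Ident C (Dom C p) \<odot> q"
    using assms pq by simp
  then show ?thesis
    by (rule epicD[OF assms(2)]) (use assms pq ob in auto)
qed

end

section \<open>Duality by the involution\<close>

context involution_category
begin

lemma star_arr [simp]:
  assumes "f \<in> Arr C"
  shows "star f \<in> Arr C" "Dom C (star f) = Cod C f" "Cod C (star f) = Dom C f"
  using star_in_hom[of f "Dom C f" "Cod C f"] assms by (auto simp: hom_def)

lemma star_comp_arr:
  assumes "f \<in> Arr C" "g \<in> Arr C" "Dom C f = Cod C g"
  shows "star (f \<odot> g) = star g \<odot> star f"
  using star_Comp[of f "Dom C f" "Cod C f" g "Dom C g"] assms by (auto simp: hom_def)

declare star_star [simp]

lemma star_zero_arrow:
  assumes "zero_arrow C f"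
  shows "zero_arrow C (star f)"
proof -
  obtain Z k h where Z: "zero_object C Z" and k: "k \<in> hom C (Dom C f) Z"
    and h: "h \<in> hom C Z (Cod C f)" and f: "f = h \<odot> k"
    using assms by (rule zero_arrowE)
  have "star f = star k \<odot> star h" by (subst f) (rule star_Comp[OF h k])
  then show ?thesis using zero_arrowI[OF Z star_in_hom[OF h] star_in_hom[OF k]] by simp
qed

lemma epic_imp_monic_star:
  assumes "epic C f"
  shows "monic C (star f)"
  unfolding monic_def
proof (intro conjI allI ballI impI)
  have f: "f \<in> Arr C" using assms by (simp add: epic_def)
  then show "star f \<in> Arr C" by simp
  fix X g h
  assume gh: "g \<in> hom C X (Dom C (star f))" "h \<in> hom C X (Dom C (star f))"
    and "star f \<odot> g = star f \<odot> h"
  then have "star (star f \<odot> g) = star (star f \<odot> h)" by simp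
  then have "star g \<odot> f = star h \<odot> f"
    using gh f by (auto simp: star_comp_arr hom_def)
  then have "star g = star h"
    using epicD[OF assms] gh f by (auto simp: hom_def)
  then show "g = h" using gh star_star by (metis (no_types, lifting) hom_def mem_Collect_eq)
qed

lemma kernel_imp_cokernel_star:
  assumes "is_kernel C f k"
  shows "is_cokernel C (star f) (star k)"
  unfolding is_cokernel_def
proof (intro conjI allI ballI impI)
  have k: "f \<in> Arr C" "k \<in> Arr C" "Cod C k = Dom C f" "zero_arrow C (f \<odot> k)"
    using assms by (auto simp: is_kernel_def)
  then show "star f \<in> Arr C" "star k \<in> Arr C" "Dom C (star k) = Cod C (star f)"
    "zero_arrow C (star k \<odot> star f)"
    using star_zero_arrow[OF k(4)] by (auto simp: star_comp_arr)
  fix X g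
  assume "g \<in> hom C (Cod C (star f)) X" and zero: "zero_arrow C (g \<odot> star f)"
  then have g: "g \<in> Arr C" "Dom C g = Dom C f" "Cod C g = X"
    using k by (auto simp: hom_def)
  have "zero_arrow C (f \<odot> star g)"
    using star_zero_arrow[OF zero] g k by (simp add: star_comp_arr)
  moreover have "star g \<in> hom C X (Dom C f)" using g by (simp add: hom_def)
  ultimately obtain h where h: "h \<in> hom C X (Dom C k)" "k \<odot> h = star g"
    using assms unfolding is_kernel_def by blast
  show "\<exists>!h. h \<in> hom C (Cod C (star k)) X \<and> h \<odot> star k = g"
  proof (intro ex1I conjI)
    show "star h \<in> hom C (Cod C (star k)) X" using h k by (auto simp: hom_def)
    show "star h \<odot> star k = g"
      using h k g star_comp_arr[of k h] by (auto simp: hom_def)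
    fix l
    assume l: "l \<in> hom C (Cod C (star k)) X \<and> l \<odot> star k = g"
    then have "k \<odot> star l = star g"
      using k star_comp_arr[of l "star k"] by (auto simp: hom_def)
    then have "star l = h"
      using monicD[OF kernel_monic[OF assms], of "star l" h] h l k by (auto simp: hom_def)
    then show "l = star h" using l by (auto simp: hom_def)
  qed
qed

section \<open>Annihilator projections\<close>

lemma projectionD:
  assumes "projection C star i"
  shows "i \<in> Arr C" "Cod C i = Dom C i" "i \<odot> i = i" "star i = i"
  using assms by (auto simp: projection_def)

lemma projection_fix_iff:
  assumes "projection C star e" "g \<in> Arr C" "Cod C g = Dom C e"
  shows "e \<odot> g = g \<longleftrightarrow> (\<exists>h \<in> Arr C. Cod C h = Dom C e \<and> g = e \<odot> h)"
proof
  assume "\<exists>h \<in> Arr C. Cod C h = Dom C e \<and> g = e \<odot> h"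
  then obtain h where "h \<in> Arr C" "Cod C h = Dom C e" "g = e \<odot> h" by blast
  then show "e \<odot> g = g"
    using projectionD[OF assms(1)] by (simp flip: comp_assoc_arr)
qed (use assms in \<open>auto intro!: bexI[of _ g]\<close>)

text \<open>The range of a projection consists of the arrows that it fixes, so membership in the
  right ideal that \<open>e\<close> generates can be tested by an equation.\<close>

lemma is_ann_projection_iff:
  "is_ann_projection C star f e \<longleftrightarrow> projection C star e \<and> Dom C e = Dom C f \<and>
    (\<forall>g \<in> Arr C. Cod C g = Dom C f \<longrightarrow> (zero_arrow C (f \<odot> g) \<longleftrightarrow> e \<odot> g = g))"
proof (cases "projection C star e \<and> Dom C e = Dom C f")
  case True
  then have e: "e \<in> Arr C" "Cod C e = Dom C f" "Dom C e = Dom C f"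
    using projectionD[of e] by auto
  have "{e \<odot> h |h. h \<in> Arr C \<and> Cod C h = Dom C f} = {g \<in> Arr C. Cod C g = Dom C f \<and> e \<odot> g = g}"
    using True e projection_fix_iff[of e] by auto
  then have "is_ann_projection C star f e \<longleftrightarrow>
    {g \<in> Arr C. Cod C g = Dom C f \<and> zero_arrow C (f \<odot> g)} =
    {g \<in> Arr C. Cod C g = Dom C f \<and> e \<odot> g = g}"
    using True by (simp add: is_ann_projection_def)
  then show ?thesis using True by blast
qed (auto simp: is_ann_projection_def)

lemma is_ann_projection_zero_iff:
  assumes "is_ann_projection C star f e" "g \<in> Arr C" "Cod C g = Dom C f"
  shows "zero_arrow C (f \<odot> g) \<longleftrightarrow> e \<odot> g = g"
  using assms by (simp add: is_ann_projection_iff)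

lemma is_ann_projectionD:
  assumes "is_ann_projection C star f e"
  shows "projection C star e" "Dom C e = Dom C f" "zero_arrow C (f \<odot> e)"
  using assms projectionD[of e] by (auto simp: is_ann_projection_iff)

text \<open>The involution turns \<open>e' \<odot> e = e\<close> into \<open>e \<odot> e' = e\<close>: the range of a self-adjoint
  idempotent determines it, whereas idempotents in general also depend on a complement.\<close>

lemma projections_eqI:
  assumes "projection C star e" "projection C star e'" "Dom C e = Dom C e'"
    and "e \<odot> e' = e'" "e' \<odot> e = e"
  shows "e = e'"
proof -
  have "e = star (e' \<odot> e)" using assms(5) projectionD[OF assms(1)] by simp
  also have "\<dots> = e \<odot> e'"
    using assms(3) projectionD[OF assms(1)] projectionD[OF assms(2)] by (simp add: star_comp_arr)
  finally show ?thesis using assms(4) by simp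
qed

lemma is_ann_projection_unique:
  assumes "is_ann_projection C star f e" "is_ann_projection C star f e'"
  shows "e = e'"
proof (rule projections_eqI)
  note e = is_ann_projectionD[OF assms(1)] and e' = is_ann_projectionD[OF assms(2)]
  show "projection C star e" "projection C star e'" "Dom C e = Dom C e'"
    using e e' by auto
  show "e \<odot> e' = e'" "e' \<odot> e = e"
    using is_ann_projection_zero_iff[OF assms(1), of e'] is_ann_projection_zero_iff[OF assms(2), of e]
      e e' projectionD[of e] projectionD[of e'] by auto
qed

lemma baer_ann_projection:
  assumes "baer_star_category C star" "f \<in> Arr C"
  shows "is_ann_projection C star f (ann_projection C star f)"
  using assms unfolding baer_star_category_def ann_projection_def by (blast intro: theI')

section \<open>Subobjects and projections\<close>

lemma moore_penrose_projection:
  assumes "moore_penrose_inverse C star f n"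
  shows "projection C star (f \<odot> n)"
proof -
  have f: "f \<in> Arr C" "n \<in> Arr C" "Dom C n = Cod C f" "Cod C n = Dom C f"
    and eqs: "f \<odot> n \<odot> f = f" "star (f \<odot> n) = f \<odot> n"
    using assms by (auto simp: moore_penrose_inverse_def hom_def)
  have "f \<odot> n \<odot> (f \<odot> n) = f \<odot> n \<odot> f \<odot> n"
    by (rule comp_assoc_arr[symmetric]) (use f in auto)
  then show ?thesis
    using f eqs by (simp add: projection_def)
qed

text \<open>Since \<open>k \<odot> n \<odot> k = k\<close>, the projection \<open>k \<odot> n\<close> fixes exactly the arrows that factor
  through \<open>k\<close>, which are those killed by \<open>f\<close>.\<close>

lemma kernel_imp_ann_projection:
  assumes "is_kernel C f k" "moore_penrose_inverse C star k n"
  shows "is_ann_projection C star f (k \<odot> n)"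
  unfolding is_ann_projection_iff
proof (intro conjI ballI impI iffI)
  have k: "f \<in> Arr C" "k \<in> Arr C" "Cod C k = Dom C f" "zero_arrow C (f \<odot> k)"
    using assms(1) by (auto simp: is_kernel_def)
  have n: "n \<in> Arr C" "Dom C n = Cod C k" "Cod C n = Dom C k" "k \<odot> n \<odot> k = k"
    using assms(2) by (auto simp: moore_penrose_inverse_def hom_def)
  show "projection C star (k \<odot> n)" by (rule moore_penrose_projection[OF assms(2)])
  show "Dom C (k \<odot> n) = Dom C f" using k n by simp
  fix g
  assume g: "g \<in> Arr C" "Cod C g = Dom C f"
  show "k \<odot> n \<odot> g = g" if zero: "zero_arrow C (f \<odot> g)"
  proof -
    obtain h where h: "h \<in> Arr C" "Cod C h = Dom C k" "g = k \<odot> h"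
      using kernel_factor[OF assms(1) g zero] .
    have "k \<odot> n \<odot> (k \<odot> h) = k \<odot> n \<odot> k \<odot> h"
      by (rule comp_assoc_arr[symmetric]) (use k n h in auto)
    then show ?thesis unfolding h(3) n(4) .
  qed
  show "zero_arrow C (f \<odot> g)" if "k \<odot> n \<odot> g = g"
  proof -
    have "zero_arrow C (f \<odot> k \<odot> (n \<odot> g))"
      by (rule zero_arrow_comp_right) (use k n g in auto)
    then show ?thesis using that k n g by (simp add: comp_assoc_arr)
  qed
qed

text \<open>The epimorphism \<open>q\<close> can be cancelled from \<open>f \<odot> p \<odot> q = 0\<close>, and an arrow \<open>g\<close> with
  \<open>p \<odot> q \<odot> g = g\<close> factors through \<open>p\<close> by way of \<open>q \<odot> g\<close>.\<close>

lemma ann_projection_imp_kernel: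
  assumes "is_ann_projection C star f (p \<odot> q)" "f \<in> Arr C"
    and "monic C p" "epic C q" "Dom C p = Cod C q"
  shows "is_kernel C f p"
proof (rule monic_imp_is_kernel[OF assms(3,2)])
  have pq: "p \<in> Arr C" "q \<in> Arr C" using assms by (auto simp: monic_def epic_def)
  note e = is_ann_projectionD[OF assms(1)]
  have cod: "Cod C p = Dom C f" "Dom C q = Dom C f"
    using e(2) projectionD(2)[OF e(1)] pq assms(5) by auto
  then show "Cod C p = Dom C f" by simp
  have "zero_arrow C (f \<odot> p \<odot> q)"
    using e(3) pq assms(2,5) cod by (simp add: comp_assoc_arr)
  then show "zero_arrow C (f \<odot> p)"
    by (rule zero_arrow_cancel_epic[OF _ assms(4)]) (use assms pq cod in auto)
  fix g
  assume g: "g \<in> Arr C" "Cod C g = Dom C f" "zero_arrow C (f \<odot> g)"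
  then have "p \<odot> q \<odot> g = g"
    using is_ann_projection_zero_iff[OF assms(1)] by blast
  then show "\<exists>h \<in> hom C (Dom C g) (Dom C p). p \<odot> h = g"
    using g pq cod assms(5) by (intro bexI[of _ "q \<odot> g"]) (auto simp: hom_def comp_assoc_arr)
qed

section \<open>Closed projections and normality\<close>

text \<open>Write \<open>i = p \<odot> q\<close>, so that \<open>a = i'\<close> and \<open>b = i''\<close>.  Always \<open>i \<le> i''\<close>, because
  \<open>i \<odot> i' = 0\<close> is equivalent to \<open>i' \<odot> i = 0\<close> under the involution.  As \<open>p\<close> is a kernel of \<open>g\<close>,
  \<open>g\<close> kills \<open>i\<close>, so \<open>star g\<close> lies in the range of \<open>i'\<close>, that is, \<open>g = g \<odot> i'\<close>.  Hence \<open>g\<close> also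
  kills \<open>i''\<close>, which therefore factors through \<open>p\<close>; this is \<open>i'' \<le> i\<close>.\<close>

lemma kernel_imp_double_annihilator:
  assumes "projection C star (p \<odot> q)" "is_kernel C g p" "epic C q" "Dom C p = Cod C q"
    and a: "is_ann_projection C star (p \<odot> q) a" and b: "is_ann_projection C star a b"
  shows "b = p \<odot> q"
proof -
  define i where "i = p \<odot> q"
  have g: "g \<in> Arr C" "p \<in> Arr C" "Cod C p = Dom C g" "zero_arrow C (g \<odot> p)"
    using assms(2) by (auto simp: is_kernel_def)
  have q: "q \<in> Arr C" using assms(3) by (simp add: epic_def)
  note i = projectionD[OF assms(1), folded i_def]
  note a' = is_ann_projectionD[OF a, folded i_def] and a_proj = projectionD[OF is_ann_projectionD(1)[OF a]]
  note b' = is_ann_projectionD[OF b] and b_proj = projectionD[OF is_ann_projectionD(1)[OF b]]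
  have dom_i: "Dom C i = Dom C g" "Dom C q = Dom C g"
    using i(1,2) g q assms(4) by (auto simp: i_def)
  have i_le_b: "b \<odot> i = i"
  proof -
    have "zero_arrow C (a \<odot> i)"
      using star_zero_arrow[OF a'(3)] a'(2) i a_proj by (simp add: star_comp_arr)
    then show ?thesis
      using is_ann_projection_zero_iff[OF b, of i] i a'(2) by simp
  qed
  have "zero_arrow C (g \<odot> i)"
    using zero_arrow_comp_right[OF g(4) q] g q assms(4) by (simp add: i_def comp_assoc_arr)
  then have "zero_arrow C (i \<odot> star g)"
    using star_zero_arrow[of "g \<odot> i"] i g dom_i by (simp add: star_comp_arr)
  then have "a \<odot> star g = star g"
    using is_ann_projection_zero_iff[OF a, folded i_def, of "star g"] g dom_i by simp
  then have "star (a \<odot> star g) = g" using g by simp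
  then have ga: "g \<odot> a = g"
    using g a_proj a'(2) dom_i by (simp add: star_comp_arr)
  have "zero_arrow C (g \<odot> (a \<odot> b))"
    by (rule zero_arrow_comp_left) (use b'(2,3) a'(2) a_proj b_proj g dom_i in auto)
  moreover have "g \<odot> a \<odot> b = g \<odot> (a \<odot> b)"
    by (rule comp_assoc_arr) (use b'(2) a'(2) a_proj b_proj g dom_i in auto)
  ultimately have "zero_arrow C (g \<odot> b)" by (simp add: ga)
  then obtain h where h: "h \<in> Arr C" "Cod C h = Dom C p" "b = p \<odot> h"
    using kernel_factor[OF assms(2), of b] b_proj b'(2) a'(2) dom_i by metis
  have "q \<odot> p = Ident C (Dom C p)"
    by (rule idempotent_factorization_split)
      (use i g dom_i kernel_monic[OF assms(2)] assms(3,4) in \<open>auto simp: i_def\<close>)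
  then have "i \<odot> p = p"
    using g q assms(4) dom_i by (simp add: i_def comp_assoc_arr)
  moreover have "i \<odot> p \<odot> h = i \<odot> (p \<odot> h)"
    by (rule comp_assoc_arr) (use h(1,2) g i dom_i in auto)
  ultimately have b_le_i: "i \<odot> b = b" by (simp add: h(3))
  show ?thesis
    by (rule projections_eqI) (use i_le_b b_le_i b' a'(2) assms(1) in \<open>auto simp: i_def\<close>)
qed

text \<open>By the second annihilator assumption, \<open>a \<odot> g = 0\<close> amounts to \<open>m \<odot> n \<odot> g = g\<close>, that is, to
  \<open>g\<close> factoring through \<open>m\<close>.\<close>

lemma double_annihilator_imp_kernel:
  assumes "monic C m" "moore_penrose_inverse C star m n"
    and a: "is_ann_projection C star (m \<odot> n) a" and i: "is_ann_projection C star a (m \<odot> n)"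
  shows "is_kernel C a m"
proof (rule monic_imp_is_kernel[OF assms(1)])
  have n: "m \<in> Arr C" "n \<in> Arr C" "Dom C n = Cod C m" "Cod C n = Dom C m" "m \<odot> n \<odot> m = m"
    using assms(2) by (auto simp: moore_penrose_inverse_def hom_def)
  note a' = projectionD[OF is_ann_projectionD(1)[OF a]] is_ann_projectionD(2)[OF a]
  show "a \<in> Arr C" "Cod C m = Dom C a" using a' n by auto
  then show "zero_arrow C (a \<odot> m)"
    using is_ann_projection_zero_iff[OF i, of m] n by simp
  fix g
  assume g: "g \<in> Arr C" "Cod C g = Dom C a" "zero_arrow C (a \<odot> g)"
  then have "m \<odot> n \<odot> g = g" using is_ann_projection_zero_iff[OF i] by blast
  then show "\<exists>h \<in> hom C (Dom C g) (Dom C m). m \<odot> h = g"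
    using g n a' by (intro bexI[of _ "n \<odot> g"]) (auto simp: hom_def comp_assoc_arr)
qed

section \<open>Factorizations\<close>

text \<open>If \<open>f \<odot> n = p \<odot> q\<close>, then \<open>f = p \<odot> (q \<odot> f)\<close>.  The second factor is epic because \<open>q \<odot> f\<close> has
  the right inverse \<open>n \<odot> p\<close>: indeed \<open>q \<odot> f \<odot> n \<odot> p = (q \<odot> p) \<odot> (q \<odot> p) = 1\<close>.\<close>

lemma factorizable_range_imp_factorizable:
  assumes "moore_penrose_inverse C star f n" "mono_epi_factorizable C (f \<odot> n)"
  shows "mono_epi_factorizable C f"
proof -
  have f: "f \<in> Arr C" "n \<in> Arr C" "Dom C n = Cod C f" "Cod C n = Dom C f" "f \<odot> n \<odot> f = f"
    using assms(1) by (auto simp: moore_penrose_inverse_def hom_def)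
  obtain p q where pq: "monic C p" "epic C q" "Dom C p = Cod C q" "f \<odot> n = p \<odot> q"
    using assms(2) by (auto simp: mono_epi_factorizable_def)
  have arr: "p \<in> Arr C" "q \<in> Arr C" using pq by (auto simp: monic_def epic_def)
  have dom: "Cod C p = Cod C f" "Dom C q = Cod C f"
    using pq arr f comp_arr(2,3)[of f n] by auto
  have qp: "q \<odot> p = Ident C (Dom C p)"
    by (rule idempotent_factorization_split)
      (use pq dom projectionD(3)[OF moore_penrose_projection[OF assms(1)]] in auto)
  have "q \<odot> f \<odot> (n \<odot> p) = q \<odot> (f \<odot> n) \<odot> p"
    using arr f dom by (simp add: comp_assoc_arr)
  also have "\<dots> = q \<odot> p \<odot> (q \<odot> p)"
    unfolding pq(4) using arr dom pq(3) by (simp add: comp_assoc_arr)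
  also have "\<dots> = Ident C (Cod C q)"
    unfolding qp pq(3) using arr by (simp add: Cod_in_Obj)
  finally have right_inv: "q \<odot> f \<odot> (n \<odot> p) = Ident C (Cod C q)" .
  have "epic C (q \<odot> f)"
    unfolding epic_def
  proof (intro conjI allI ballI impI)
    show "q \<odot> f \<in> Arr C" using arr f dom by simp
    fix X g h
    assume gh: "g \<in> hom C (Cod C (q \<odot> f)) X" "h \<in> hom C (Cod C (q \<odot> f)) X"
      and eq: "g \<odot> (q \<odot> f) = h \<odot> (q \<odot> f)"
    then have "g \<odot> (q \<odot> f \<odot> (n \<odot> p)) = h \<odot> (q \<odot> f \<odot> (n \<odot> p))"
      using arr f dom comp_assoc_arr[of g "q \<odot> f" "n \<odot> p"] comp_assoc_arr[of h "q \<odot> f" "n \<odot> p"]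
      by (auto simp: hom_def)
    then show "g = h" using gh arr f dom right_inv by (auto simp: hom_def)
  qed
  moreover have "f = p \<odot> (q \<odot> f)"
    using f(5) arr f(1) dom pq(3) unfolding pq(4) by (simp add: comp_assoc_arr)
  ultimately show ?thesis
    using pq(1,3) arr f(1) dom unfolding mono_epi_factorizable_def
    by (intro exI[of _ p] exI[of _ "q \<odot> f"] conjI) simp_all
qed

section \<open>Exactness\<close>

lemma exact_imp_baer_star_category:
  assumes mp: "\<forall>f \<in> Arr C. \<exists>g. moore_penrose_inverse C star f g"
    and "exact_category C"
  shows "baer_star_category C star"
  unfolding baer_star_category_def
proof (intro conjI ballI)
  show "involution_category C star" by (rule involution_category_axioms)
  show "\<exists>Z. zero_object C Z" using assms(2) by (simp add: exact_category_def)
  fix f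
  assume "f \<in> Arr C"
  then obtain k where k: "is_kernel C f k" using assms(2) by (auto simp: exact_category_def)
  then obtain n where "moore_penrose_inverse C star k n" using mp by (auto simp: is_kernel_def)
  then have "is_ann_projection C star f (k \<odot> n)" by (rule kernel_imp_ann_projection[OF k])
  then have "\<exists>e. is_ann_projection C star f e" by (rule exI)
  then show "\<exists>!e. is_ann_projection C star f e"
    by (rule ex_ex1I) (rule is_ann_projection_unique)
qed

lemma exact_imp_closed_projection:
  assumes "baer_star_category C star" "exact_category C" and i: "projection C star i"
  shows "closed_projection C star i"
proof -
  obtain p q where pq: "monic C p" "epic C q" "Dom C p = Cod C q" "i = p \<odot> q"
    using assms(2) projectionD(1)[OF i] by (auto simp: exact_category_def mono_epi_factorizable_def)
  obtain g where g: "is_kernel C g p" using assms(2) pq(1) by (auto simp: exact_category_def)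
  have a: "is_ann_projection C star i (ann_projection C star i)"
    using baer_ann_projection[OF assms(1)] projectionD(1)[OF i] .
  moreover have "is_ann_projection C star (ann_projection C star i)
      (ann_projection C star (ann_projection C star i))"
    using baer_ann_projection[OF assms(1)] projectionD(1)[OF is_ann_projectionD(1)[OF a]] .
  ultimately have "ann_projection C star (ann_projection C star i) = i"
    using kernel_imp_double_annihilator[OF _ g pq(2,3)] i unfolding pq(4) by blast
  then show ?thesis using i by (simp add: closed_projection_def)
qed

lemma baer_star_imp_exact:
  assumes mp: "\<forall>f \<in> Arr C. \<exists>g. moore_penrose_inverse C star f g"
    and baer: "baer_star_category C star"
    and closed: "\<forall>i. projection C star i \<longrightarrow> closed_projection C star i"
    and fact: "\<forall>i. projection C star i \<longrightarrow> mono_epi_factorizable C i"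
  shows "exact_category C"
proof -
  have kernel: "\<exists>k. is_kernel C f k" if f: "f \<in> Arr C" for f
  proof -
    have e: "is_ann_projection C star f (ann_projection C star f)"
      using baer_ann_projection[OF baer f] .
    then obtain p q where "monic C p" "epic C q" "Dom C p = Cod C q" "ann_projection C star f = p \<odot> q"
      using fact is_ann_projectionD(1)[OF e] unfolding mono_epi_factorizable_def by blast
    then show ?thesis using ann_projection_imp_kernel[OF _ f] e by metis
  qed
  have normal: "\<exists>f. is_kernel C f m" if m: "monic C m" for m
  proof -
    obtain n where n: "moore_penrose_inverse C star m n" using mp m by (auto simp: monic_def)
    define i where "i = m \<odot> n"
    have i: "projection C star i" unfolding i_def by (rule moore_penrose_projection[OF n])
    have a: "is_ann_projection C star i (ann_projection C star i)"
      using baer_ann_projection[OF baer projectionD(1)[OF i]] .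
    have "is_ann_projection C star (ann_projection C star i)
        (ann_projection C star (ann_projection C star i))"
      using baer_ann_projection[OF baer] projectionD(1)[OF is_ann_projectionD(1)[OF a]] .
    moreover have "ann_projection C star (ann_projection C star i) = i"
      using closed i by (auto simp: closed_projection_def)
    ultimately show ?thesis
      using double_annihilator_imp_kernel[OF m n] a unfolding i_def by auto
  qed
  have cokernel: "\<exists>c. is_cokernel C f c" if f: "f \<in> Arr C" for f
    using kernel[of "star f"] kernel_imp_cokernel_star[of "star f"] f by auto
  have conormal: "\<exists>f. is_cokernel C f e" if e: "epic C e" for e
    using normal[OF epic_imp_monic_star[OF e]] kernel_imp_cokernel_star[of _ "star e"] e
    by (auto simp: epic_def)
  have "mono_epi_factorizable C f" if "f \<in> Arr C" for f
    using mp fact that moore_penrose_projection factorizable_range_imp_factorizable by blast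
  moreover have "\<exists>Z. zero_object C Z" using baer by (simp add: baer_star_category_def)
  ultimately show ?thesis
    unfolding exact_category_def
    using kernel cokernel normal conormal category_axioms by blast
qed

end

theorem theorem1p1:
  fixes C :: "('o, 'a) cat_struct" and star :: "'a \<Rightarrow> 'a"
  assumes "involution_category C star"
    and "\<forall>f \<in> Arr C. \<exists>g. moore_penrose_inverse C star f g"
  shows "exact_category C \<longleftrightarrow>
    baer_star_category C star \<and>
    (\<forall>i. projection C star i \<longrightarrow> closed_projection C star i) \<and>
    (\<forall>i. projection C star i \<longrightarrow> mono_epi_factorizable C i)"
proof -
  interpret involution_category C star by (rule assms(1))
  show ?thesis
  proof
    assume ex: "exact_category C"
    have baer: "baer_star_category C star"
      by (rule exact_imp_baer_star_category[OF assms(2) ex])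
    have "mono_epi_factorizable C i" if "projection C star i" for i
      using ex projectionD(1)[OF that] by (simp add: exact_category_def)
    then show "baer_star_category C star \<and>
      (\<forall>i. projection C star i \<longrightarrow> closed_projection C star i) \<and>
      (\<forall>i. projection C star i \<longrightarrow> mono_epi_factorizable C i)"
      using baer exact_imp_closed_projection[OF baer ex] by simp
  next
    assume "baer_star_category C star \<and>
      (\<forall>i. projection C star i \<longrightarrow> closed_projection C star i) \<and>
      (\<forall>i. projection C star i \<longrightarrow> mono_epi_factorizable C i)"
    then show "exact_category C"
      by (elim conjE) (rule baer_star_imp_exact[OF assms(2)])
  qed
qed

end
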